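(* There exists an absolute constant $C_0$ with $0<C_0<1/4$ such that the following holds for all positive integers $N$ and $\omega$. Let $\lambda_1,\lambda_2,\ldots,\lambda_N$ be real numbers such that, whenever $u_1,\ldots,u_N$ are integers with $u_1\lambda_1+\cdots+u_N\lambda_N=0$ and $\max_{1\le \ell\le N}|u_\ell|\le 6\,\omega\log\frac{N\omega}{C_0}$, one has $u_1=u_2=\cdots=u_N=0$. Put $$\Xi=\Xi(N,\omega):=\min\Big\{\Big|\sum_{k=1}^N \lambda_k u_k\Big| \;:\; u_1,\ldots,u_N\in\mathbf{Z},\ |u_k|\le 6\,\omega\log\frac{N\omega}{C_0}\ (1\le k\le N),\ u_1\lambda_1+\cdots+u_N\lambda_N\neq 0\Big\},$$ and let $T$ be a real number with $$T>\frac{3}{\pi\,\Xi}\left(\frac{2\sqrt{3}\,\omega}{C_0}\sqrt{\log\frac{N\omega}{C_0}}\right)^{N}.$$ Then for any real numbers $d,\beta_1,\ldots,\beta_N$ there exists a real number $t\in[d,d+T]$ such that $$\sup_{1\le j\le N}\,\|t\lambda_j-\beta_j\|\le\frac{1}{\omega}.$$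
   Context: For a real number $x$, $\|x\|=\min_{\nu\in\mathbf{Z}}|x-\nu|$ denotes the distance from $x$ to the nearest integer. The constant $C_0$ is absolute: it does not depend on $N$, $\omega$, the $\lambda_j$, $d$, the $\beta_j$ or $T$. $\log$ is the natural logarithm. *)

theory Defs
  imports "HOL-Analysis.Analysis"
begin

(* The infimum is attained, see the lemma below. *)
definition dist_int :: "real \<Rightarrow> real" where
  "dist_int x = (INF n::int. \<bar>x - of_int n\<bar>)"

lemma dist_int_attained: "\<exists>n::int. dist_int x = \<bar>x - of_int n\<bar> \<and> (\<forall>m::int. \<bar>x - of_int n\<bar> \<le> \<bar>x - of_int m\<bar>)"
proof -
  have least: "\<bar>x - of_int (round x)\<bar> \<le> \<bar>x - of_int m\<bar>" for m :: int
    using round_diff_minimal[of x m] by (simp add: abs_minus_commute)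
  have "dist_int x = \<bar>x - of_int (round x)\<bar>"
    unfolding dist_int_def
  proof (rule antisym)
    show "(INF n::int. \<bar>x - of_int n\<bar>) \<le> \<bar>x - of_int (round x)\<bar>"
      by (rule cINF_lower) (auto intro!: bdd_belowI2[where m = 0])
    show "\<bar>x - of_int (round x)\<bar> \<le> (INF n::int. \<bar>x - of_int n\<bar>)"
      by (rule cINF_greatest) (use least in auto)
  qed
  with least show ?thesis by blast
qed

definition coeff_bound :: "real \<Rightarrow> nat \<Rightarrow> nat \<Rightarrow> real" where
  "coeff_bound C N \<omega> = 6 * real \<omega> * ln (real N * real \<omega> / C)"

(* Vectors indexed by 1,...,N are functions on nat of which only the values on {1..N} matter. *)
definition Xi_values :: "real \<Rightarrow> nat \<Rightarrow> nat \<Rightarrow> (nat \<Rightarrow> real) \<Rightarrow> real set" where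
  "Xi_values C N \<omega> lam =
     {\<bar>\<Sum>k=1..N. lam k * of_int (u k)\<bar> | u :: nat \<Rightarrow> int.
        (\<forall>k\<in>{1..N}. \<bar>of_int (u k)\<bar> \<le> coeff_bound C N \<omega>) \<and>
        (\<Sum>k=1..N. of_int (u k) * lam k) \<noteq> 0}"

definition Xi :: "real \<Rightarrow> nat \<Rightarrow> nat \<Rightarrow> (nat \<Rightarrow> real) \<Rightarrow> real" where
  "Xi C N \<omega> lam = Min (Xi_values C N \<omega> lam)"

definition bounded_independent :: "real \<Rightarrow> nat \<Rightarrow> nat \<Rightarrow> (nat \<Rightarrow> real) \<Rightarrow> bool" where
  "bounded_independent C N \<omega> lam \<longleftrightarrow>
     (\<forall>u :: nat \<Rightarrow> int.
        (\<Sum>k=1..N. of_int (u k) * lam k) = 0 \<longrightarrow>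
        (MAX l\<in>{1..N}. \<bar>of_int (u l)\<bar>) \<le> coeff_bound C N \<omega> \<longrightarrow>
        (\<forall>l\<in>{1..N}. u l = 0))"

(* The minimum defining Xi is over a finite nonempty set. *)
lemma finite_Xi_values: "finite (Xi_values C N \<omega> lam)"
proof -
  let ?B = "\<lfloor>coeff_bound C N \<omega>\<rfloor>"
  let ?F = "PiE {1..N} (\<lambda>_. {-?B..?B})"
  have "Xi_values C N \<omega> lam \<subseteq> (\<lambda>u. \<bar>\<Sum>k=1..N. lam k * of_int (u k)\<bar>) ` ?F"
  proof
    fix x assume "x \<in> Xi_values C N \<omega> lam"
    then obtain u :: "nat \<Rightarrow> int" where
      x: "x = \<bar>\<Sum>k=1..N. lam k * of_int (u k)\<bar>" and
      u: "\<forall>k\<in>{1..N}. \<bar>of_int (u k)\<bar> \<le> coeff_bound C N \<omega>"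
      unfolding Xi_values_def by blast
    have "\<bar>u k\<bar> \<le> ?B" if "k \<in> {1..N}" for k
      using u that by (simp add: le_floor_iff)
    then have "restrict u {1..N} \<in> ?F" by (fastforce simp: abs_le_iff)
    moreover have "x = \<bar>\<Sum>k=1..N. lam k * of_int (restrict u {1..N} k)\<bar>"
      unfolding x by simp
    ultimately show "x \<in> (\<lambda>u. \<bar>\<Sum>k=1..N. lam k * of_int (u k)\<bar>) ` ?F" by blast
  qed
  moreover have "finite ?F" by (intro finite_PiE) auto
  ultimately show ?thesis using finite_surj by blast
qed

lemma coeff_bound_ge_1:
  assumes "0 < C" "C < 1/4" "N > 0" "\<omega> > 0"
  shows "1 \<le> coeff_bound C N \<omega>"
proof -
  have "1 \<le> real N * real \<omega>" using assms mult_mono[of 1 "real N" 1 "real \<omega>"] by simp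
  then have "4 * C \<le> real N * real \<omega>" using assms by linarith
  then have "4 \<le> real N * real \<omega> / C" using assms by (simp add: field_simps)
  moreover have "exp 1 \<le> (4::real)" using exp_le by linarith
  ultimately have "exp 1 \<le> real N * real \<omega> / C" by linarith
  moreover from this have "0 < real N * real \<omega> / C" using exp_gt_zero[of "1::real"] by linarith
  ultimately have "1 \<le> ln (real N * real \<omega> / C)" by (simp only: ln_ge_iff)
  then have "1 * 1 \<le> (6 * real \<omega>) * ln (real N * real \<omega> / C)"
    using assms by (intro mult_mono) auto
  then show ?thesis by (simp add: coeff_bound_def)
qed

lemma Xi_values_nonempty:
  assumes "0 < C" "C < 1/4" "N > 0" "\<omega> > 0" and ind: "bounded_independent C N \<omega> lam"
  shows "Xi_values C N \<omega> lam \<noteq> {}"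
proof -
  define u :: "nat \<Rightarrow> int" where "u = (\<lambda>k. if k = 1 then 1 else 0)"
  have B: "1 \<le> coeff_bound C N \<omega>" using coeff_bound_ge_1 assms by blast
  have 1: "\<forall>k\<in>{1..N}. \<bar>of_int (u k)\<bar> \<le> coeff_bound C N \<omega>"
    using B by (auto simp: u_def)
  then have "(MAX l\<in>{1..N}. \<bar>of_int (u l)\<bar>) \<le> coeff_bound C N \<omega>"
    using \<open>N > 0\<close> by (subst Max_le_iff) auto
  moreover have "\<not> (\<forall>l\<in>{1..N}. u l = 0)" using \<open>N > 0\<close> by (force simp: u_def)
  ultimately have "(\<Sum>k=1..N. of_int (u k) * lam k) \<noteq> 0"
    using ind unfolding bounded_independent_def by blast
  with 1 show ?thesis unfolding Xi_values_def by blast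
qed

end

theory Submission
  imports Defs
begin

text \<open>
  Let \<open>K\<close> be the Jackson-type kernel \<open>\<bar>((1/L) \<Sum>i<L. e(i x)) ^ m\<bar>\<^sup>2\<close>
  with \<open>L = 2 \<omega>\<close> and \<open>m\<close> about \<open>log (N \<omega> / C\<^sub>0)\<close>. Its coefficients are nonnegative with sum
  \<open>1\<close>, it is at most \<open>\<eta> = 16 ^ (- m)\<close> at distance more than \<open>1 / \<omega>\<close> from the integers, and its
  mean \<open>a\<^sub>0\<close> has order \<open>1 / (L \<surd>m)\<close>, so that \<open>N \<eta> \<le> a\<^sub>0 / 2\<close>. If every \<open>t\<close> in the interval had a bad
  index, then \<open>(\<Prod>k. K(\<theta>\<^sub>k)) \<le> \<eta> (\<Sum>j. \<Prod>k\<noteq>j. K(\<theta>\<^sub>k))\<close> with \<open>\<theta>\<^sub>k = t \<lambda>\<^sub>k - \<beta>\<^sub>k\<close>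
  on the whole interval. Integrating over \<open>t\<close> (that is, comparing antiderivatives), each product contributes \<open>T\<close> times its zero
  coefficient up to an error \<open>1 / (\<pi> \<Xi>)\<close>, which forces \<open>T \<le> 3 / (\<pi> \<Xi>) a\<^sub>0 ^ (- N)\<close>.
\<close>

section \<open>The sine against the distance to the nearest integer\<close>

text \<open>Jordan's inequality: a concave function lies above its chord, here the one from
  \<open>0\<close> to \<open>pi/2\<close>.\<close>

lemma sin_ge_two_pi_mult:
  fixes x :: real
  assumes "0 \<le> x" "x \<le> pi/2"
  shows "2 / pi * x \<le> sin x"
proof -
  have "concave_on {0..pi/2} (sin :: real \<Rightarrow> real)"
    by (rule f''_le0_imp_concave[where f' = cos and f'' = "\<lambda>x. - sin x"])
       (auto intro!: derivative_eq_intros sin_ge_zero)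
  from concave_onD_Icc'[OF this, of x] assms show ?thesis
    by (simp add: field_simps)
qed

text \<open>Shifting \<open>x\<close> by its nearest integer changes \<open>sin (pi * x)\<close> at
  most in sign and brings \<open>x\<close> into \<open>[-1/2, 1/2]\<close>, where Jordan's
  inequality applies.\<close>

lemma abs_sin_pi_ge_dist_int: "2 * dist_int x \<le> \<bar>sin (pi * x)\<bar>"
proof -
  obtain n :: int where n: "dist_int x = \<bar>x - of_int n\<bar>"
    "\<And>m::int. \<bar>x - of_int n\<bar> \<le> \<bar>x - of_int m\<bar>"
    using dist_int_attained by blast
  define y where "y = x - of_int n"
  have "\<bar>y\<bar> \<le> 1/2"
    using n(2)[of "round x"] of_int_round_abs_le[of x] by (simp add: y_def abs_minus_commute)
  have "pi * x = pi * y + pi * of_int n" by (simp add: y_def algebra_simps)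
  then have "\<bar>sin (pi * x)\<bar> = \<bar>sin (pi * y)\<bar>"
    by (simp add: sin_add abs_mult cos_npi_int)
  also have "\<dots> = \<bar>sin (pi * \<bar>y\<bar>)\<bar>" by (simp add: abs_if)
  finally have "\<bar>sin (pi * x)\<bar> = \<bar>sin (pi * \<bar>y\<bar>)\<bar>" .
  moreover have "2 / pi * (pi * \<bar>y\<bar>) \<le> sin (pi * \<bar>y\<bar>)"
    using \<open>\<bar>y\<bar> \<le> 1/2\<close> by (intro sin_ge_two_pi_mult) auto
  ultimately show ?thesis using n(1) by (simp add: y_def)
qed

section \<open>The random walk behind the kernel: mass, generating function, variance\<close>

text \<open>\<open>walk L m n\<close> is the probability that a sum of \<open>m\<close> independent uniform variables on
  \<open>{0..<L}\<close> equals \<open>n\<close>, so Chebyshev's inequality controls the mean of the kernel.\<close>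
fun walk :: "nat \<Rightarrow> nat \<Rightarrow> nat \<Rightarrow> real" where
  "walk L 0 n = (if n = 0 then 1 else 0)"
| "walk L (Suc m) n = (\<Sum>i<L. if i \<le> n then walk L m (n - i) else 0) / L"

lemma walk_nonneg: "0 \<le> walk L m n"
  by (induction m arbitrary: n) (auto intro!: divide_nonneg_nonneg sum_nonneg)

text \<open>Conditioning the expectation of \<open>h\<close> on the newest step. The codomain of
  \<open>h\<close> is a general vector space because the rule is used with real values for the mass
  and the variance, and with complex values for the generating function.\<close>

lemma sum_walk_Suc:
  fixes h :: "nat \<Rightarrow> 'a::real_vector"
  shows "(\<Sum>n\<le>Suc m * L. walk L (Suc m) n *\<^sub>R h n) =
         (1 / L) *\<^sub>R (\<Sum>i<L. \<Sum>n\<le>m * L. walk L m n *\<^sub>R h (n + i))"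
proof -
  \<comment> \<open>Steps are below \<open>L\<close>, so the cutoff \<open>m * L\<close> loses no
    mass.\<close>
  have zero: "walk L m n = 0" if "n > m * L" for m n
    using that
    by (induction m arbitrary: n) (auto intro!: sum.neutral)
  have shift: "(\<Sum>n\<le>Suc m * L. (if i \<le> n then walk L m (n - i) else 0) *\<^sub>R h n) =
        (\<Sum>n\<le>m * L. walk L m n *\<^sub>R h (n + i))" if "i < L" for i
  proof -
    have "(\<Sum>n\<le>Suc m * L. (if i \<le> n then walk L m (n - i) else 0) *\<^sub>R h n) =
          (\<Sum>n\<in>{i..m * L + i}. walk L m (n - i) *\<^sub>R h n)"
      using that zero by (intro sum.mono_neutral_cong_right) auto
    also have "\<dots> = (\<Sum>n\<le>m * L. walk L m n *\<^sub>R h (n + i))"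
      by (rule sum.reindex_bij_witness[of _ "\<lambda>n. n + i" "\<lambda>n. n - i"]) auto
    finally show ?thesis .
  qed
  have "(\<Sum>i<L. \<Sum>n\<le>Suc m * L. (if i \<le> n then walk L m (n - i) else 0) *\<^sub>R h n) =
      (\<Sum>i<L. \<Sum>n\<le>m * L. walk L m n *\<^sub>R h (n + i))"
    by (rule sum.cong) (use shift in auto)
  moreover have "walk L (Suc m) n *\<^sub>R h n =
      (1 / L) *\<^sub>R (\<Sum>i<L. (if i \<le> n then walk L m (n - i) else 0) *\<^sub>R h n)" for n
    by (simp add: divide_inverse_commute flip: scaleR_sum_left)
  ultimately show ?thesis
    by (simp only: sum.swap[of _ "{..<L}"] flip: scaleR_sum_right)
qed

lemma sum_walk: "L > 0 \<Longrightarrow> (\<Sum>n\<le>m * L. walk L m n) = 1"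
proof (induction m)
  case (Suc m)
  then show ?case using sum_walk_Suc[of L m "\<lambda>_. 1::real"] by simp
qed simp

text \<open>Generating functions of independent steps multiply; this links the walk to a power of a
  geometric sum.\<close>

lemma sum_walk_power:
  fixes z :: complex
  shows "(\<Sum>n\<le>m * L. walk L m n *\<^sub>R z ^ n) = ((\<Sum>i<L. z ^ i) / of_nat L) ^ m"
proof (induction m)
  case (Suc m)
  have "(\<Sum>n\<le>m * L. walk L m n *\<^sub>R z ^ (n + i)) = ((\<Sum>i<L. z ^ i) / of_nat L) ^ m * z ^ i" for i
    unfolding Suc.IH[symmetric] sum_distrib_right power_add by simp
  then have "(\<Sum>n\<le>Suc m * L. walk L (Suc m) n *\<^sub>R z ^ n) =
      (1 / L) *\<^sub>R (((\<Sum>i<L. z ^ i) / of_nat L) ^ m * (\<Sum>i<L. z ^ i))"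
    unfolding sum_walk_Suc by (simp add: sum_distrib_left)
  then show ?case
    by (simp add: scaleR_conv_of_real del: walk.simps)
qed simp

text \<open>Variances of independent steps add. The hypothesis on \<open>c\<close> says that it is
  the mean of one step.\<close>

lemma sum_walk_square_dev:
  assumes "L > 0" and c: "(\<Sum>i<L. real i - c) = 0"
  shows "(\<Sum>n\<le>m * L. walk L m n * (real n - m * c)\<^sup>2) = m * ((\<Sum>i<L. (real i - c)\<^sup>2) / L)"
proof (induction m)
  case (Suc m)
  let ?v = "(\<Sum>i<L. (real i - c)\<^sup>2) / L"
  let ?E = "\<lambda>h. \<Sum>n\<le>m * L. walk L m n * h n"
  have "?E (\<lambda>n. (real (n + i) - real (Suc m) * c)\<^sup>2) =
      m * ?v + (2 * ?E (\<lambda>n. real n - m * c)) * (real i - c) + (real i - c)\<^sup>2" for i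
  proof -
    have "?E (\<lambda>n. (real (n + i) - real (Suc m) * c)\<^sup>2) =
        ?E (\<lambda>n. (real n - m * c)\<^sup>2) + ?E (\<lambda>n. 2 * (real i - c) * (real n - m * c))
        + ?E (\<lambda>n. (real i - c)\<^sup>2)"
      unfolding sum.distrib[symmetric]
      by (intro sum.cong refl) (simp add: algebra_simps power2_eq_square)
    \<comment> \<open>The cross term is a multiple of \<open>real i - c\<close>, so it vanishes once
      summed over \<open>i\<close>.\<close>
    moreover have "?E (\<lambda>n. 2 * (real i - c) * (real n - m * c)) =
        (2 * ?E (\<lambda>n. real n - m * c)) * (real i - c)"
      unfolding sum_distrib_left sum_distrib_right by (intro sum.cong refl) (simp add: algebra_simps)
    moreover have "?E (\<lambda>n. (real i - c)\<^sup>2) = (real i - c)\<^sup>2"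
      using sum_walk[OF \<open>L > 0\<close>, of m] by (simp flip: sum_distrib_right)
    ultimately show ?thesis using Suc.IH by simp
  qed
  then have "(\<Sum>i<L. ?E (\<lambda>n. (real (n + i) - real (Suc m) * c)\<^sup>2)) = L * (m * ?v) + L * ?v"
    using c \<open>L > 0\<close> by (simp add: sum.distrib flip: sum_distrib_left)
  then show ?case
    using sum_walk_Suc[of L m "\<lambda>n. (real n - real (Suc m) * c)\<^sup>2"] \<open>L > 0\<close>
    by (simp add: field_simps del: walk.simps of_nat_Suc of_nat_add) (simp add: field_simps)
qed simp

section \<open>Fourier coefficients of a squared modulus\<close>

text \<open>These are the Fourier coefficients of the squared modulus of the trigonometric
  polynomial with coefficients \<open>b 0, ..., b D\<close>.\<close>

definition autocorr :: "nat \<Rightarrow> (nat \<Rightarrow> real) \<Rightarrow> int \<Rightarrow> real" where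
  "autocorr D b u = (\<Sum>n\<le>D. \<Sum>k\<le>D. if int n - int k = u then b n * b k else 0)"

text \<open>Groups the pairs \<open>(n, k)\<close> by their difference, which stays between
  \<open>- D\<close> and \<open>D\<close>.\<close>

lemma sum_autocorr:
  fixes h :: "int \<Rightarrow> 'a::real_vector"
  shows "(\<Sum>u\<in>{- int D..int D}. autocorr D b u *\<^sub>R h u) =
         (\<Sum>n\<le>D. \<Sum>k\<le>D. (b n * b k) *\<^sub>R h (int n - int k))"
proof -
  have "(\<Sum>u\<in>{- int D..int D}. (if int n - int k = u then b n * b k else 0) *\<^sub>R h u) =
        (b n * b k) *\<^sub>R h (int n - int k)" if "n \<le> D" "k \<le> D" for n k
    using that by (simp add: if_distrib[of "\<lambda>x. x *\<^sub>R _"] sum.delta cong: if_cong)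
  then show ?thesis
    unfolding autocorr_def scaleR_sum_left
    by (simp add: sum.swap[of _ "{..D}" "{- int D..int D}"])
qed

lemma autocorr_nonneg: "(\<And>n. 0 \<le> b n) \<Longrightarrow> 0 \<le> autocorr D b u"
  unfolding autocorr_def by (intro sum_nonneg) auto

lemma sum_autocorr_eq_square: "(\<Sum>u\<in>{- int D..int D}. autocorr D b u) = (\<Sum>n\<le>D. b n)\<^sup>2"
  using sum_autocorr[of D b "\<lambda>_. 1::real"] by (simp add: power2_eq_square sum_product)

lemma autocorr_0: "autocorr D b 0 = (\<Sum>n\<le>D. (b n)\<^sup>2)"
  unfolding autocorr_def by (simp add: power2_eq_square)

lemma norm_square_eq_sum_autocorr:
  "complex_of_real ((norm (\<Sum>n\<le>D. b n *\<^sub>R cis (2 * pi * x) ^ n))\<^sup>2) =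
     (\<Sum>u\<in>{- int D..int D}. of_real (autocorr D b u) * cis (2 * pi * (of_int u * x)))"
proof -
  let ?z = "cis (2 * pi * x)"
  have *: "?z ^ n * cnj (?z ^ k) = cis (2 * pi * (of_int (int n - int k) * x))" for n k
    by (simp add: cis_cnj cis_mult Complex.DeMoivre algebra_simps)
  have "complex_of_real ((norm (\<Sum>n\<le>D. b n *\<^sub>R ?z ^ n))\<^sup>2) =
      (\<Sum>n\<le>D. \<Sum>k\<le>D. (b n * b k) *\<^sub>R (?z ^ n * cnj (?z ^ k)))"
    unfolding complex_norm_square by (simp add: sum_product scaleR_conv_of_real mult_ac)
  also have "\<dots> = (\<Sum>u\<in>{- int D..int D}. autocorr D b u *\<^sub>R cis (2 * pi * (of_int u * x)))"
    unfolding sum_autocorr * ..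
  finally show ?thesis by (simp add: scaleR_conv_of_real)
qed

section \<open>Lower bound for the mean of the kernel\<close>

lemma card_nat_near_le:
  assumes "r \<ge> 0"
  shows "real (card {n::nat. \<bar>real n - x\<bar> \<le> r}) \<le> 2 * r + 1"
proof -
  let ?S = "{n::nat. \<bar>real n - x\<bar> \<le> r}" and ?T = "{\<lceil>x - r\<rceil>..\<lfloor>x + r\<rfloor>}"
  have "int ` ?S \<subseteq> ?T" by (auto simp: le_floor_iff ceiling_le_iff)
  then have "card (int ` ?S) \<le> card ?T" by (intro card_mono) auto
  then have "real (card ?S) \<le> real (nat (\<lfloor>x + r\<rfloor> - \<lceil>x - r\<rceil> + 1))"
    by (simp add: card_image)
  also have "\<dots> \<le> 2 * r + 1"
    using assms by linarith
  finally show ?thesis .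
qed

lemma sum_centered_eq_0: "(\<Sum>i<L. real i - (real L - 1) / 2) = 0"
proof -
  have "2 * (\<Sum>i<L. real i) = real L * (real L - 1)"
    by (induction L) (simp_all add: algebra_simps)
  then show ?thesis by (simp add: sum_subtractf)
qed

text \<open>By Chebyshev, most of the mass sits on at most \<open>2 * r + 1\<close> points around
  the mean; by Cauchy-Schwarz, the sum of squares is then at least of order
  \<open>1 / r\<close>.\<close>

lemma autocorr_walk_0_ge:
  assumes "L > 0" "m > 0"
  shows "1 / (4 * real L * sqrt (real m) + 2) \<le> autocorr (m * L) (walk L m) 0"
proof -
  define c where "c = (real L - 1) / 2"
  \<comment> \<open>Each step deviates from its mean by at most \<open>L / 2\<close>, so the
    variance is at most \<open>r^2 / 4\<close>. Thus \<open>r\<close> is at least two standard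
    deviations, and the tail beyond it has mass at most \<open>1/4\<close>.\<close>
  define r where "r = real L * sqrt (real m)"
  define S where "S = {n. \<bar>real n - m * c\<bar> \<le> r}"
  let ?D = "{..m * L}"
  have "r > 0" using assms by (simp add: r_def)
  have "(\<Sum>i<L. (real i - c)\<^sup>2) \<le> real (card {..<L}) * (real L / 2)\<^sup>2"
    by (intro sum_bounded_above power2_le_iff_abs_le[THEN iffD2]) (auto simp: c_def abs_le_iff field_simps)
  then have "(\<Sum>i<L. (real i - c)\<^sup>2) / L \<le> (real L)\<^sup>2 / 4"
    using \<open>L > 0\<close> by (simp add: field_simps power2_eq_square)
  then have "m * ((\<Sum>i<L. (real i - c)\<^sup>2) / L) \<le> m * ((real L)\<^sup>2 / 4)"
    by (rule mult_left_mono) simp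
  moreover have "(\<Sum>n\<in>?D. walk L m n * (real n - m * c)\<^sup>2) = m * ((\<Sum>i<L. (real i - c)\<^sup>2) / L)"
    using sum_walk_square_dev[OF \<open>L > 0\<close>] sum_centered_eq_0[of L] by (simp only: c_def)
  ultimately have "(\<Sum>n\<in>?D. walk L m n * (real n - m * c)\<^sup>2) \<le> m * ((real L)\<^sup>2 / 4)"
    by linarith
  also have "\<dots> = r\<^sup>2 / 4" by (simp add: r_def power_mult_distrib)
  finally have V: "(\<Sum>n\<in>?D. walk L m n * (real n - m * c)\<^sup>2) \<le> r\<^sup>2 / 4" .
  have "(\<Sum>n\<in>?D - S. walk L m n) * r\<^sup>2 \<le> (\<Sum>n\<in>?D - S. walk L m n * (real n - m * c)\<^sup>2)"
    unfolding sum_distrib_right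
  proof (intro sum_mono mult_left_mono walk_nonneg)
    fix n assume "n \<in> ?D - S"
    then have "r \<le> \<bar>real n - m * c\<bar>" by (simp add: S_def)
    then show "r\<^sup>2 \<le> (real n - m * c)\<^sup>2"
      using \<open>r > 0\<close> by (simp add: abs_le_square_iff[symmetric])
  qed
  also have "\<dots> \<le> (\<Sum>n\<in>?D. walk L m n * (real n - m * c)\<^sup>2)"
    by (intro sum_mono2) (auto simp: walk_nonneg)
  also note V
  finally have "(\<Sum>n\<in>?D - S. walk L m n) \<le> 1/4" using \<open>r > 0\<close> by (simp add: field_simps)
  moreover have "(\<Sum>n\<in>?D. walk L m n) = (\<Sum>n\<in>?D - S. walk L m n) + (\<Sum>n\<in>?D \<inter> S. walk L m n)"
    by (subst sum.Int_Diff[where B = S]) auto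
  ultimately have "3/4 \<le> (\<Sum>n\<in>?D \<inter> S. walk L m n)"
    using sum_walk[OF \<open>L > 0\<close>, of m] by simp
  then have "(3/4)\<^sup>2 \<le> (\<Sum>n\<in>?D \<inter> S. walk L m n)\<^sup>2"
    by (intro power_mono) auto
  also have "\<dots> \<le> (\<Sum>n\<in>?D \<inter> S. (walk L m n)\<^sup>2) * card (?D \<inter> S)"
    by (rule sum_squared_le_sum_of_squares)
  also have "\<dots> \<le> autocorr (m * L) (walk L m) 0 * (2 * r + 1)"
  proof (rule mult_mono)
    show "(\<Sum>n\<in>?D \<inter> S. (walk L m n)\<^sup>2) \<le> autocorr (m * L) (walk L m) 0"
      unfolding autocorr_0 by (intro sum_mono2) auto
    have "finite S"
      by (rule finite_subset[of _ "{..nat \<lfloor>m * c + r\<rfloor>}"]) (auto simp: S_def le_nat_floor)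
    then have "card (?D \<inter> S) \<le> card S" by (intro card_mono) auto
    then show "real (card (?D \<inter> S)) \<le> 2 * r + 1"
      using card_nat_near_le[of r "m * c"] \<open>r > 0\<close> by (simp add: S_def)
  qed (use autocorr_nonneg walk_nonneg in auto)
  \<comment> \<open>The constant \<open>9/16\<close> is relaxed to \<open>1/2\<close>.\<close>
  finally have "1/2 \<le> autocorr (m * L) (walk L m) 0 * (2 * r + 1)" by (simp add: power2_eq_square)
  then show ?thesis
    using \<open>r > 0\<close> by (simp add: field_simps r_def)
qed

section \<open>The kernel and its decay away from the integers\<close>

text \<open>This is the \<open>2 * m\<close>-th power of the modulus of a normalised geometric sum,
  by \<open>sum_walk_power\<close>. The expanded form exhibits the coefficients to which
  \<open>autocorr\<close> applies.\<close>

definition jackson :: "nat \<Rightarrow> nat \<Rightarrow> real \<Rightarrow> real" where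
  "jackson L m x = (norm (\<Sum>n\<le>m * L. walk L m n *\<^sub>R cis (2 * pi * x) ^ n))\<^sup>2"

text \<open>The geometric sum is at most \<open>2 / norm (z - 1)\<close> with
  \<open>z = cis (2 * pi * x)\<close>, and the denominator is
  \<open>2 * \<bar>sin (pi * x)\<bar>\<close>, hence at least \<open>4 * dist_int x\<close>.\<close>

lemma jackson_le:
  assumes "L > 0" "dist_int x > 0"
  shows "jackson L m x \<le> (1 / (2 * real L * dist_int x)) ^ (2 * m)"
proof -
  let ?z = "cis (2 * pi * x)"
  have "norm (?z - 1) = 2 * \<bar>sin (pi * x)\<bar>"
    using dist_exp_i_1[of "2 * pi * x"] by (simp add: cis_conv_exp)
  then have z: "4 * dist_int x \<le> norm (?z - 1)"
    using abs_sin_pi_ge_dist_int[of x] by simp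
  then have "?z \<noteq> 1" using assms by auto
  have "norm (\<Sum>i<L. ?z ^ i) = norm (?z ^ L - 1) / norm (?z - 1)"
    using \<open>?z \<noteq> 1\<close> by (simp add: geometric_sum norm_divide)
  also have "\<dots> \<le> 2 / (4 * dist_int x)"
    using norm_triangle_ineq4[of "?z ^ L" 1] z assms by (intro frac_le) (auto simp: norm_power)
  finally have "norm ((\<Sum>i<L. ?z ^ i) / of_nat L) \<le> 1 / (2 * real L * dist_int x)"
    using assms by (simp add: norm_divide field_simps)
  moreover have "jackson L m x = norm ((\<Sum>i<L. ?z ^ i) / of_nat L) ^ (2 * m)"
    unfolding jackson_def sum_walk_power norm_power by (simp only: mult.commute flip: power_mult)
  ultimately show ?thesis by (simp add: power_mono)
qed

section \<open>Means of trigonometric sums along an interval\<close>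

text \<open>Termwise integration: the zero frequency gives the linear main term, and every other
  term is a sine divided by at least \<open>2 * pi * \<delta>\<close>, whose increments are bounded
  independently of the interval.\<close>

lemma cos_sum_antiderivative:
  fixes A \<Lambda> B :: "'a \<Rightarrow> real"
  assumes S: "finite S" "z \<in> S" and z: "\<Lambda> z = 0" "B z = 0"
    and A: "\<And>s. s \<in> S \<Longrightarrow> 0 \<le> A s"
    and gap: "0 < \<delta>"
      "\<And>s. s \<in> S \<Longrightarrow> s \<noteq> z \<Longrightarrow> \<delta> \<le> \<bar>\<Lambda> s\<bar>"
  obtains G where
    "\<And>t. (G has_real_derivative (\<Sum>s\<in>S. A s * cos (2 * pi * (t * \<Lambda> s - B s)))) (at t)"
    "\<And>a b. \<bar>G b - G a - (b - a) * A z\<bar> \<le> (\<Sum>s\<in>S. A s) / (pi * \<delta>)"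
proof
  define w where "w s t = A s * (sin (2 * pi * (t * \<Lambda> s - B s)) / (2 * pi * \<Lambda> s))" for s t
  define G where "G t = A z * t + (\<Sum>s\<in>S - {z}. w s t)" for t
  have nz: "\<Lambda> s \<noteq> 0" if "s \<in> S - {z}" for s
    using gap that by fastforce
  show "(G has_real_derivative (\<Sum>s\<in>S. A s * cos (2 * pi * (t * \<Lambda> s - B s)))) (at t)" for t
    unfolding G_def w_def sum.remove[OF S] using nz
    by (auto intro!: derivative_eq_intros sum.cong simp: z field_simps)
  show "\<bar>G b - G a - (b - a) * A z\<bar> \<le> (\<Sum>s\<in>S. A s) / (pi * \<delta>)" for a b
  proof -
    have "\<bar>w s b - w s a\<bar> \<le> A s / (pi * \<delta>)" if s: "s \<in> S - {z}" for s
    proof -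
      let ?f = "\<lambda>t. sin (2 * pi * (t * \<Lambda> s - B s))"
      have "\<bar>w s b - w s a\<bar> = A s * (\<bar>?f b - ?f a\<bar> / (2 * pi * \<bar>\<Lambda> s\<bar>))"
        using A s by (simp add: w_def abs_mult flip: right_diff_distrib diff_divide_distrib)
      also have "\<dots> \<le> A s * (2 / (2 * pi * \<delta>))"
      proof (intro mult_left_mono frac_le)
        have "\<bar>?f b\<bar> \<le> 1" "\<bar>?f a\<bar> \<le> 1" by simp_all
        then show "\<bar>?f b - ?f a\<bar> \<le> 2" by linarith
      qed (use A s gap in auto)
      finally show ?thesis by simp
    qed
    then have "(\<Sum>s\<in>S - {z}. \<bar>w s b - w s a\<bar>) \<le> (\<Sum>s\<in>S - {z}. A s / (pi * \<delta>))"
      by (intro sum_mono)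
    also have "\<dots> \<le> (\<Sum>s\<in>S. A s / (pi * \<delta>))"
      using S A gap by (intro sum_mono2) auto
    finally have "\<bar>\<Sum>s\<in>S - {z}. w s b - w s a\<bar> \<le> (\<Sum>s\<in>S. A s) / (pi * \<delta>)"
      using sum_abs[of "\<lambda>s. w s b - w s a" "S - {z}"] unfolding sum_divide_distrib by linarith
    then show ?thesis by (simp add: G_def sum_subtractf algebra_simps)
  qed
qed

text \<open>Expanding the product gives one exponential for each integer vector \<open>p\<close> in
  a box. The gap keeps every frequency except that of the zero vector away from \<open>0\<close>,
  and the coefficients still sum to \<open>1\<close>.\<close>

lemma product_antiderivative:
  fixes a :: "int \<Rightarrow> real" and K :: "real \<Rightarrow> real" and M :: nat
  assumes I: "finite I" and a: "\<And>u. 0 \<le> a u" "(\<Sum>u\<in>{- int M..int M}. a u) = 1"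
    and K: "\<And>x. complex_of_real (K x) =
      (\<Sum>u\<in>{- int M..int M}. of_real (a u) * cis (2 * pi * (of_int u * x)))"
    and gap: "0 < \<delta>"
      "\<And>p. (\<And>k. k \<in> I \<Longrightarrow> \<bar>p k\<bar> \<le> int M) \<Longrightarrow>
        \<exists>k\<in>I. p k \<noteq> 0 \<Longrightarrow> \<delta> \<le> \<bar>\<Sum>k\<in>I. of_int (p k) * lam k\<bar>"
  obtains G where
    "\<And>t. (G has_real_derivative (\<Prod>k\<in>I. K (t * lam k - \<beta> k))) (at t)"
    "\<And>c d. \<bar>G d - G c - (d - c) * a 0 ^ card I\<bar> \<le> 1 / (pi * \<delta>)"
proof -
  let ?U = "{- int M..int M}"
  define S where "S = PiE I (\<lambda>_. ?U)"
  \<comment> \<open>The zero vector must be restricted to \<open>I\<close> to belong to the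
    extensional space \<open>S\<close>.\<close>
  define z :: "'a \<Rightarrow> int" where "z = (\<lambda>k\<in>I. 0)"
  define \<Lambda> where "\<Lambda> p = (\<Sum>k\<in>I. of_int (p k) * lam k)" for p :: "'a \<Rightarrow> int"
  define B where "B p = (\<Sum>k\<in>I. of_int (p k) * \<beta> k)" for p :: "'a \<Rightarrow> int"
  define A where "A p = (\<Prod>k\<in>I. a (p k))" for p
  have cis_sum: "(\<Prod>k\<in>I. cis (f k)) = cis (\<Sum>k\<in>I. f k)" for f :: "'a \<Rightarrow> real"
    using I by induction (auto simp: cis_mult)
  have P: "(\<Prod>k\<in>I. K (t * lam k - \<beta> k)) = (\<Sum>p\<in>S. A p * cos (2 * pi * (t * \<Lambda> p - B p)))" for t
  proof -
    have "complex_of_real (\<Prod>k\<in>I. K (t * lam k - \<beta> k)) =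
        (\<Sum>p\<in>S. of_real (A p) * cis (2 * pi * (t * \<Lambda> p - B p)))"
      unfolding of_real_prod K S_def A_def \<Lambda>_def B_def
      by (subst prod_sum_PiE)
         (use I in \<open>auto simp: prod.distrib cis_sum sum_distrib_left sum_subtractf right_diff_distrib mult_ac\<close>)
    \<comment> \<open>The kernel and the coefficients are real, so real parts turn exponentials into
      cosines.\<close>
    from arg_cong[OF this, of Re] show ?thesis by (simp del: of_real_prod)
  qed
  have "z \<in> S" by (auto simp: S_def z_def)
  have "(\<Sum>p\<in>S. A p) = 1"
    unfolding S_def A_def by (subst prod_sum_PiE[symmetric]) (use I a in auto)
  moreover have "A z = a 0 ^ card I" by (simp add: A_def z_def)
  moreover obtain G where
    "\<And>t. (G has_real_derivative (\<Sum>s\<in>S. A s * cos (2 * pi * (t * \<Lambda> s - B s)))) (at t)"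
    "\<And>a b. \<bar>G b - G a - (b - a) * A z\<bar> \<le> (\<Sum>s\<in>S. A s) / (pi * \<delta>)"
  proof (rule cos_sum_antiderivative[of S z \<Lambda> B A \<delta>])
    show "finite S" unfolding S_def using I by (intro finite_PiE) auto
    show "z \<in> S" using \<open>z \<in> S\<close> .
    show "\<delta> \<le> \<bar>\<Lambda> s\<bar>" if "s \<in> S" "s \<noteq> z" for s
      unfolding \<Lambda>_def
    proof (rule gap(2))
      show "\<exists>k\<in>I. s k \<noteq> 0"
        using that PiE_ext[of s I _ z] \<open>z \<in> S\<close> unfolding S_def z_def by force
    qed (use that in \<open>force simp: S_def abs_le_iff\<close>)
  qed (use a gap in \<open>auto simp: \<Lambda>_def B_def A_def z_def intro: prod_nonneg\<close>)
  ultimately show ?thesis by (intro that[of G]) (simp_all add: P)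
qed

section \<open>The averaging argument\<close>

text \<open>If the conclusion failed, the main term \<open>T * a 0 ^ card I\<close> would be at most
  half of itself up to errors independent of \<open>T\<close>, which bounds
  \<open>T\<close>.\<close>

lemma simultaneous_kernel_lower_bound:
  fixes a :: "int \<Rightarrow> real" and K :: "real \<Rightarrow> real" and M :: nat and \<delta> \<eta> :: real
  assumes I: "finite I" "I \<noteq> {}" and a: "\<And>u. 0 \<le> a u" "(\<Sum>u\<in>{- int M..int M}. a u) = 1" "0 < a 0"
    and K: "\<And>x. complex_of_real (K x) =
      (\<Sum>u\<in>{- int M..int M}. of_real (a u) * cis (2 * pi * (of_int u * x)))"
    and K_nonneg: "\<And>x. 0 \<le> K x"
    and gap: "0 < \<delta>"
      "\<And>p. (\<And>k. k \<in> I \<Longrightarrow> \<bar>p k\<bar> \<le> int M) \<Longrightarrow>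
        \<exists>k\<in>I. p k \<noteq> 0 \<Longrightarrow> \<delta> \<le> \<bar>\<Sum>k\<in>I. of_int (p k) * lam k\<bar>"
    and \<eta>: "0 \<le> \<eta>" "card I * \<eta> \<le> a 0 / 2"
    and T: "T > 3 / (pi * \<delta>) * (1 / a 0) ^ card I"
  obtains t where "t \<in> {d..d + T}" "\<And>j. j \<in> I \<Longrightarrow> \<eta> < K (t * lam j - \<beta> j)"
proof (rule ccontr)
  assume "\<not> thesis"
  with that have bad: "\<forall>t\<in>{d..d + T}. \<exists>j\<in>I. K (t * lam j - \<beta> j) \<le> \<eta>"
    by (meson not_less)
  define P where "P J t = (\<Prod>k\<in>J. K (t * lam k - \<beta> k))" for J t
  have "T > 0"
    using T gap a by (smt (verit) divide_nonneg_pos mult_nonneg_nonneg pi_gt_zero zero_le_power mult_pos_pos)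
  have P_nonneg: "0 \<le> P J t" for J t unfolding P_def by (intro prod_nonneg) (auto simp: K_nonneg)
  define e where "e = 1 / (pi * \<delta>)"
  have "e > 0" using gap by (simp add: e_def)
  define prim where "prim J G \<longleftrightarrow> (\<forall>t. (G has_real_derivative P J t) (at t)) \<and>
      (\<forall>c d. \<bar>G d - G c - (d - c) * a 0 ^ card J\<bar> \<le> e)" for J and G :: "real \<Rightarrow> real"
  have "\<exists>G. prim J G" if "J \<subseteq> I" for J
  proof -
    \<comment> \<open>Extending a vector by zero from \<open>J\<close> to \<open>I\<close> passes
      the gap on to subfamilies; the cases \<open>J = I\<close> and \<open>J = I - {j}\<close> are
      used below.\<close>
    have gapJ: "\<delta> \<le> \<bar>\<Sum>k\<in>J. of_int (p k) * lam k\<bar>"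
      if p: "\<And>k. k \<in> J \<Longrightarrow> \<bar>p k\<bar> \<le> int M" "\<exists>k\<in>J. p k \<noteq> 0" for p :: "'a \<Rightarrow> int"
    proof -
      have "(\<Sum>k\<in>I. of_int (if k \<in> J then p k else 0) * lam k) = (\<Sum>k\<in>J. of_int (p k) * lam k)"
        using \<open>J \<subseteq> I\<close> I by (intro sum.mono_neutral_cong_right) auto
      moreover have "\<exists>k\<in>I. (if k \<in> J then p k else 0) \<noteq> 0"
        using p(2) \<open>J \<subseteq> I\<close> by auto
      ultimately show ?thesis
        using gap(2)[of "\<lambda>k. if k \<in> J then p k else 0"] p(1) by auto
    qed
    have "finite J" using I \<open>J \<subseteq> I\<close> finite_subset by blast
    then show ?thesis
    proof (rule product_antiderivative[OF _ a(1,2) K gap(1) gapJ, where \<beta> = \<beta>])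
      fix G assume "\<And>t. (G has_real_derivative (\<Prod>k\<in>J. K (t * lam k - \<beta> k))) (at t)"
        "\<And>c d. \<bar>G d - G c - (d - c) * a 0 ^ card J\<bar> \<le> 1 / (pi * \<delta>)"
      then show ?thesis unfolding prim_def P_def e_def by blast
    qed
  qed
  then have "\<forall>J\<in>Pow I. \<exists>G. prim J G" by blast
  then obtain G where "\<forall>J\<in>Pow I. prim J (G J)" using bchoice by blast
  then have G: "(G J has_real_derivative P J t) (at t)"
    "\<bar>G J d - G J c - (d - c) * a 0 ^ card J\<bar> \<le> e" if "J \<subseteq> I" for J t c d
    using that unfolding prim_def by auto
  \<comment> \<open>An antiderivative of the full product minus \<open>\<eta>\<close> times the sum
    of the products with one factor removed; a bad index at every \<open>t\<close> makes
    \<open>H\<close> nonincreasing on the interval.\<close>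
  define H where "H t = G I t - \<eta> * (\<Sum>j\<in>I. G (I - {j}) t)" for t
  have "H (d + T) \<le> H d"
  proof (rule DERIV_nonpos_imp_nonincreasing[where f = H])
    fix t assume t: "d \<le> t" "t \<le> d + T"
    have deriv: "(H has_real_derivative P I t - \<eta> * (\<Sum>j\<in>I. P (I - {j}) t)) (at t)"
      unfolding H_def by (auto intro!: derivative_eq_intros G)
    obtain j where j: "j \<in> I" "K (t * lam j - \<beta> j) \<le> \<eta>" using bspec[OF bad, of t] t by auto
    then have "P I t = K (t * lam j - \<beta> j) * P (I - {j}) t"
      using I by (simp add: P_def prod.remove)
    then have "P I t \<le> \<eta> * P (I - {j}) t"
      using j P_nonneg by (simp add: mult_right_mono)
    \<comment> \<open>The bad index depends on \<open>t\<close>, so all indices are summed; the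
      added terms are nonnegative.\<close>
    also have "\<dots> \<le> \<eta> * (\<Sum>j\<in>I. P (I - {j}) t)"
      using I j P_nonneg \<eta> by (intro mult_left_mono member_le_sum) auto
    finally have "P I t - \<eta> * (\<Sum>j\<in>I. P (I - {j}) t) \<le> 0" by simp
    with deriv show "\<exists>y. (H has_real_derivative y) (at t) \<and> y \<le> 0" by blast
  qed (use \<open>T > 0\<close> in simp)
  moreover have "G I (d + T) - G I d \<ge> T * a 0 ^ card I - e"
    using G(2)[of I "d + T" d] by (simp add: abs_le_iff)
  moreover have "\<eta> * (\<Sum>j\<in>I. G (I - {j}) (d + T) - G (I - {j}) d) \<le> a 0 / 2 * (T * a 0 ^ (card I - 1) + e)"
  proof -
    have "G (I - {j}) (d + T) - G (I - {j}) d \<le> T * a 0 ^ (card I - 1) + e" if "j \<in> I" for j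
      using G(2)[of "I - {j}" "d + T" d] that I by (simp add: abs_le_iff)
    then have "(\<Sum>j\<in>I. G (I - {j}) (d + T) - G (I - {j}) d) \<le> card I * (T * a 0 ^ (card I - 1) + e)"
      by (rule sum_bounded_above)
    then have "\<eta> * (\<Sum>j\<in>I. G (I - {j}) (d + T) - G (I - {j}) d) \<le> (card I * \<eta>) * (T * a 0 ^ (card I - 1) + e)"
      using \<eta> by (simp add: mult_left_mono mult_ac)
    also have "\<dots> \<le> a 0 / 2 * (T * a 0 ^ (card I - 1) + e)"
      using \<eta> \<open>T > 0\<close> \<open>e > 0\<close> a by (intro mult_right_mono) auto
    finally show ?thesis .
  qed
  ultimately have "T * a 0 ^ card I - e \<le> a 0 / 2 * (T * a 0 ^ (card I - 1) + e)"
    by (simp add: H_def sum_subtractf right_diff_distrib)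
  \<comment> \<open>Nonemptiness of \<open>I\<close> lets the factor \<open>a 0\<close> restore the
    exponent \<open>card I\<close>.\<close>
  also have "\<dots> = T * a 0 ^ card I / 2 + a 0 / 2 * e"
    using I by (cases "card I") (auto simp: field_simps)
  \<comment> \<open>With \<open>a 0\<close> at most \<open>1\<close> the errors add up to
    \<open>e + e / 2\<close>; absorbing half of the main term doubles this to \<open>3 * e\<close>,
    the source of the \<open>3\<close> in the bound on \<open>T\<close>.\<close>
  also have "a 0 \<le> 1"
    using member_le_sum[of 0 "{- int M..int M}" a] a by simp
  then have "a 0 / 2 * e \<le> e / 2" using \<open>e > 0\<close> by simp
  finally have "T * a 0 ^ card I \<le> 3 * e" by simp
  then have "T \<le> 3 * e / a 0 ^ card I"
    using a by (simp add: pos_le_divide_eq)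
  also have "\<dots> = 3 / (pi * \<delta>) * (1 / a 0) ^ card I"
    by (simp add: e_def power_divide)
  finally have "T \<le> 3 / (pi * \<delta>) * (1 / a 0) ^ card I" .
  then show False using T by simp
qed

section \<open>The frequency gap supplied by \<open>Xi\<close>\<close>

lemma Xi_pos:
  assumes "0 < C" "C < 1/4" "N > 0" "\<omega> > 0" "bounded_independent C N \<omega> lam"
  shows "0 < Xi C N \<omega> lam"
proof -
  have "Xi C N \<omega> lam \<in> Xi_values C N \<omega> lam"
    unfolding Xi_def using assms by (intro Min_in finite_Xi_values Xi_values_nonempty)
  then show ?thesis by (auto simp: Xi_values_def mult.commute)
qed

text \<open>Independence makes the linear form nonzero at every nonzero vector in range, so its
  absolute value competes in the minimum.\<close>

lemma Xi_le:
  fixes u :: "nat \<Rightarrow> int"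
  assumes "bounded_independent C N \<omega> lam" "N > 0"
    and u: "\<And>k. k \<in> {1..N} \<Longrightarrow> \<bar>of_int (u k)\<bar> \<le> coeff_bound C N \<omega>" "\<exists>k\<in>{1..N}. u k \<noteq> 0"
  shows "Xi C N \<omega> lam \<le> \<bar>\<Sum>k\<in>{1..N}. of_int (u k) * lam k\<bar>"
proof -
  have "(MAX l\<in>{1..N}. \<bar>of_int (u l)\<bar>) \<le> coeff_bound C N \<omega>"
    using u(1) \<open>N > 0\<close> by (subst Max_le_iff) auto
  then have "(\<Sum>k=1..N. of_int (u k) * lam k) \<noteq> 0"
    using assms(1) u(2) unfolding bounded_independent_def by blast
  then have "\<bar>\<Sum>k=1..N. lam k * of_int (u k)\<bar> \<in> Xi_values C N \<omega> lam"
    using u(1) unfolding Xi_values_def by blast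
  then show ?thesis
    unfolding Xi_def by (simp add: Min_le finite_Xi_values mult.commute)
qed

lemma jackson_nonneg: "0 \<le> jackson L m x"
  by (simp add: jackson_def)

section \<open>Numerical choice of the parameters\<close>

text \<open>The exponent \<open>m\<close> must be small enough for the degree
  \<open>2 * \<omega> * m\<close> to fit the coefficient range and for \<open>1 / \<alpha>\<close>
  to stay below the base in the bound on \<open>T\<close>, yet large enough for
  \<open>16 ^ m\<close> to outweigh \<open>2 * N / \<alpha>\<close>. Rounding \<open>ln X\<close> up
  does both.\<close>

lemma kernel_parameters:
  fixes \<omega> N :: nat
  assumes "\<omega> > 0" "N > 0"
  defines "X \<equiv> real N * real \<omega> / (1/100)"
  defines "m \<equiv> nat \<lceil>ln X\<rceil>"
  defines "\<alpha> \<equiv> autocorr (m * (2 * \<omega>)) (walk (2 * \<omega>) m) 0"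
  shows "m > 0" "real (m * (2 * \<omega>)) \<le> coeff_bound (1/100) N \<omega>"
    and "0 < \<alpha>" "1 / \<alpha> \<le> 2 * sqrt 3 * real \<omega> / (1/100) * sqrt (ln X)"
    and "N * (1 / 16) ^ m \<le> \<alpha> / 2"
proof -
  have "1 \<le> real N * real \<omega>" using assms mult_mono[of 1 "real N" 1 "real \<omega>"] by simp
  then have X: "X \<ge> 100" by (simp add: X_def)
  have "exp 1 \<le> X" using exp_le X by linarith
  then have ln: "1 \<le> ln X" using X by (simp add: ln_ge_iff)
  then have "ln X \<le> m" unfolding m_def by linarith
  then show "m > 0" using ln by linarith
  have "m \<le> ln X + 1" unfolding m_def using ln by linarith
  then have m2: "m \<le> 2 * ln X" using ln by linarith
  have "real \<omega> * m \<le> real \<omega> * (2 * ln X)" by (intro mult_left_mono m2) simp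
  moreover have "0 \<le> real \<omega> * ln X" using ln by simp
  ultimately show "real (m * (2 * \<omega>)) \<le> coeff_bound (1/100) N \<omega>"
    by (simp add: coeff_bound_def X_def mult_ac)
  define s where "s = sqrt (ln X)"
  have s: "1 \<le> s" using ln by (simp add: s_def)
  \<comment> \<open>From \<open>m \<le> 2 * ln X\<close>, with \<open>2\<close> relaxed to the
    square \<open>9/4\<close>.\<close>
  have "sqrt m \<le> sqrt ((3/2)\<^sup>2 * ln X)"
    using m2 ln by (intro real_sqrt_le_mono) (simp add: power2_eq_square)
  also have "\<dots> = 3/2 * s" unfolding s_def by (subst real_sqrt_mult) simp
  finally have "real \<omega> * sqrt m \<le> real \<omega> * (3/2 * s)" by (intro mult_left_mono) auto
  moreover have "1 \<le> real \<omega> * s"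
    using s assms mult_mono[of 1 "real \<omega>" 1 s] by simp
  \<comment> \<open>The constant is \<open>8 * 3/2 + 2 = 14\<close>.\<close>
  ultimately have "4 * real (2 * \<omega>) * sqrt m + 2 \<le> 14 * (real \<omega> * s)"
    by simp
  moreover have "0 < 4 * real (2 * \<omega>) * sqrt m + 2" by (intro add_nonneg_pos) auto
  ultimately have "1 / (14 * (real \<omega> * s)) \<le> 1 / (4 * real (2 * \<omega>) * sqrt m + 2)"
    by (intro frac_le) auto
  also have "\<dots> \<le> \<alpha>"
    unfolding \<alpha>_def using assms \<open>m > 0\<close> by (intro autocorr_walk_0_ge) auto
  finally have \<alpha>: "1 / (14 * (real \<omega> * s)) \<le> \<alpha>" .
  moreover have "0 < 1 / (14 * (real \<omega> * s))" using \<open>1 \<le> real \<omega> * s\<close> by simp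
  ultimately show "0 < \<alpha>" by linarith
  then have "1 / \<alpha> \<le> 14 * (real \<omega> * s)"
    using \<alpha> \<open>1 \<le> real \<omega> * s\<close> by (simp add: field_simps)
  also have "\<dots> \<le> (200 * sqrt 3) * (real \<omega> * s)"
  proof (rule mult_right_mono)
    have "1 \<le> sqrt 3" by simp
    then show "14 \<le> 200 * sqrt 3" by linarith
  qed (use \<open>1 \<le> real \<omega> * s\<close> in simp)
  finally show "1 / \<alpha> \<le> 2 * sqrt 3 * real \<omega> / (1/100) * sqrt (ln X)"
    by (simp add: s_def mult_ac)
  have "s \<le> s * s" using s by simp
  also have "\<dots> = ln X" using ln by (simp add: s_def)
  also have "\<dots> \<le> X" using X ln_le_minus_one[of X] by linarith
  finally have "s \<le> X" .
  \<comment> \<open>The target is \<open>28 * N * \<omega> * s \<le> 16 ^ m\<close>, where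
    \<open>28\<close> is twice \<open>14\<close>. Since \<open>X = 100 * N * \<omega>\<close>, the
    left side is below \<open>X ^ 2\<close>, which is at most \<open>exp (2 * m)\<close>.\<close>
  have "28 * (real N * real \<omega> * s) \<le> 28 * (real N * real \<omega> * X)"
    using \<open>s \<le> X\<close> by (intro mult_left_mono) auto
  also have "\<dots> \<le> X\<^sup>2" by (simp add: X_def power2_eq_square)
  also have "\<dots> = exp (2 * ln X)" using X by (simp add: exp_double)
  also have "\<dots> \<le> exp (real m * 2)" using \<open>ln X \<le> m\<close> by simp
  also have "\<dots> = exp 2 ^ m" by (simp add: exp_of_nat_mult)
  also have "\<dots> \<le> 16 ^ m"
  proof (rule power_mono)
    have "exp 2 = exp 1 * exp (1::real)" by (simp flip: exp_add)
    also have "\<dots> \<le> 3 * 3" using exp_le by (intro mult_mono) auto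
    finally show "exp 2 \<le> (16::real)" by simp
  qed simp
  finally have "28 * (real N * real \<omega> * s) \<le> 16 ^ m" .
  then have "N * (1 / 16) ^ m \<le> 1 / (14 * (real \<omega> * s)) / 2"
    using \<open>1 \<le> real \<omega> * s\<close> by (simp add: field_simps power_divide)
  also have "\<dots> \<le> \<alpha> / 2" by (rule divide_right_mono[OF \<alpha>]) simp
  finally show "N * (1 / 16) ^ m \<le> \<alpha> / 2" .
qed

section \<open>From large kernel values to simultaneous approximation\<close>

theorem theorem1:
  "\<exists>C\<^sub>0::real. 0 < C\<^sub>0 \<and> C\<^sub>0 < 1/4 \<and>
     (\<forall>(N::nat) (\<omega>::nat) (lam :: nat \<Rightarrow> real) (T::real).
        N > 0 \<longrightarrow> \<omega> > 0 \<longrightarrow>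
        bounded_independent C\<^sub>0 N \<omega> lam \<longrightarrow>
        T > 3 / (pi * Xi C\<^sub>0 N \<omega> lam) *
              (2 * sqrt 3 * real \<omega> / C\<^sub>0 * sqrt (ln (real N * real \<omega> / C\<^sub>0))) ^ N \<longrightarrow>
        (\<forall>(d::real) (\<beta> :: nat \<Rightarrow> real). \<exists>t\<in>{d..d+T}.
           (SUP j\<in>{1..N}. dist_int (t * lam j - \<beta> j)) \<le> 1 / real \<omega>))"
\<comment> \<open>The constant \<open>1/100\<close> makes the argument of the logarithm at least
  \<open>100\<close>, and provides the slack used in \<open>kernel_parameters\<close>.\<close>
proof (intro exI[of _ "1/100"] conjI allI impI)
  fix N \<omega> :: nat and lam \<beta> :: "nat \<Rightarrow> real" and T d :: real
  let ?C = "1/100 :: real"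
  define m where "m = nat \<lceil>ln (real N * real \<omega> / ?C)\<rceil>"
  define L where "L = 2 * \<omega>"
  define \<alpha> where "\<alpha> = autocorr (m * L) (walk L m) 0"
  define \<Xi> where "\<Xi> = Xi ?C N \<omega> lam"
  assume pos: "N > 0" "\<omega> > 0" and ind: "bounded_independent ?C N \<omega> lam"
    and T: "T > 3 / (pi * Xi ?C N \<omega> lam) *
      (2 * sqrt 3 * real \<omega> / ?C * sqrt (ln (real N * real \<omega> / ?C))) ^ N"
  note par = kernel_parameters[OF pos(2,1), folded m_def L_def, folded \<alpha>_def]
  have "\<Xi> > 0" unfolding \<Xi>_def using pos ind by (intro Xi_pos) auto
  have "L > 0" using pos by (simp add: L_def)
  obtain t where t: "t \<in> {d..d + T}" and
    K: "\<And>j. j \<in> {1..N} \<Longrightarrow> (1/16) ^ m < jackson L m (t * lam j - \<beta> j)"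
  proof (rule simultaneous_kernel_lower_bound
      [of "{1..N}" "autocorr (m * L) (walk L m)" "m * L" "jackson L m" \<Xi> lam "(1/16) ^ m" T d \<beta>])
    show "\<Xi> \<le> \<bar>\<Sum>k\<in>{1..N}. of_int (p k) * lam k\<bar>"
      if p: "\<And>k. k \<in> {1..N} \<Longrightarrow> \<bar>p k\<bar> \<le> int (m * L)" "\<exists>k\<in>{1..N}. p k \<noteq> 0" for p
      unfolding \<Xi>_def
    proof (rule Xi_le[OF ind pos(1) _ p(2)])
      fix k assume "k \<in> {1..N}"
      from p(1)[OF this] have "\<bar>real_of_int (p k)\<bar> \<le> real (m * L)" by linarith
      then show "\<bar>real_of_int (p k)\<bar> \<le> coeff_bound ?C N \<omega>" using par(2) by linarith
    qed
    show "T > 3 / (pi * \<Xi>) * (1 / autocorr (m * L) (walk L m) 0) ^ card {1..N}"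
    proof (rule order.strict_trans1[OF _ T])
      show "3 / (pi * \<Xi>) * (1 / autocorr (m * L) (walk L m) 0) ^ card {1..N} \<le>
        3 / (pi * Xi ?C N \<omega> lam) *
        (2 * sqrt 3 * real \<omega> / ?C * sqrt (ln (real N * real \<omega> / ?C))) ^ N"
        using par(3,4) \<open>\<Xi> > 0\<close> unfolding \<alpha>_def \<Xi>_def card_atLeastAtMost diff_Suc_1
        by (intro mult_left_mono power_mono) auto
    qed
    show "complex_of_real (jackson L m x) =
        (\<Sum>u\<in>{- int (m * L)..int (m * L)}.
          of_real (autocorr (m * L) (walk L m) u) * cis (2 * pi * (of_int u * x)))" for x
      unfolding jackson_def by (rule norm_square_eq_sum_autocorr)
    show "(\<Sum>u\<in>{- int (m * L)..int (m * L)}. autocorr (m * L) (walk L m) u) = 1"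
      using sum_walk[OF \<open>L > 0\<close>, of m] unfolding sum_autocorr_eq_square by simp
  qed (use pos par \<open>\<Xi> > 0\<close> in \<open>auto simp: \<alpha>_def autocorr_nonneg walk_nonneg jackson_nonneg\<close>)
  have "dist_int (t * lam j - \<beta> j) \<le> 1 / \<omega>" if "j \<in> {1..N}" for j
  proof (rule ccontr)
    let ?x = "t * lam j - \<beta> j"
    assume "\<not> dist_int ?x \<le> 1 / \<omega>"
    then have far: "1 / \<omega> < dist_int ?x" by simp
    moreover have "0 < 1 / real \<omega>" using pos by simp
    ultimately have "0 < dist_int ?x" by linarith
    \<comment> \<open>Here \<open>L = 2 * \<omega>\<close> matters: a distance above
      \<open>1 / \<omega>\<close> makes the denominator exceed \<open>4\<close>, and the power
      \<open>2 * m\<close> turns \<open>1/4\<close> into the threshold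
      \<open>(1/16) ^ m\<close>.\<close>
    have "1 / (2 * real L * dist_int ?x) \<le> 1 / 4"
      using far pos \<open>0 < dist_int ?x\<close> by (simp add: L_def field_simps)
    then have "(1 / (2 * real L * dist_int ?x)) ^ (2 * m) \<le> (1 / 4) ^ (2 * m)"
      using \<open>0 < dist_int ?x\<close> by (intro power_mono) auto
    also have "\<dots> = (1 / 16) ^ m" by (simp add: power_mult power2_eq_square)
    finally show False
      using K[OF that] jackson_le[OF \<open>L > 0\<close> \<open>0 < dist_int ?x\<close>, of m] by linarith
  qed
  then have "(SUP j\<in>{1..N}. dist_int (t * lam j - \<beta> j)) \<le> 1 / real \<omega>"
    using pos by (intro cSUP_least) auto
  then show "\<exists>t\<in>{d..d+T}. (SUP j\<in>{1..N}. dist_int (t * lam j - \<beta> j)) \<le> 1 / real \<omega>"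
    using t by blast
qed simp_all

end
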